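(* Let $I_N$ denote the number of consecutive irreducible polynomial sequences of length $N$ over $\mathbb{F}_q$. The following hold: (1) $I_2 = \frac{1}{2}(q-1)^3$; (2) $I_3 \ge \frac{1}{6}(q-1)^2(q-9)(q-2\sqrt{q}-6)$ when $q > 13$.
   Context: Let $p$ be an odd prime, $q=p^s$ with $s\ge 1$ an integer, and $\mathbb{F}_q$ the finite field with $q$ elements. A consecutive irreducible polynomial sequence of length $N$ over $\mathbb{F}_q$ is a sequence $f_1,\ldots,f_N$ with $f_n=u_nX^n+\cdots+u_1X+u_0\in\mathbb{F}_q[X]$, where $u_0,u_1,\ldots,u_N$ are non-zero elements of $\mathbb{F}_q$, such that every $f_n$ ($1\le n\le N$) is irreducible over $\mathbb{F}_q$. Thus $I_N$ is the number of such tuples $(u_0,\ldots,u_N)$. *)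

theory Defs
  imports Complex_Main "HOL-Library.Cardinality" "HOL-Computational_Algebra.Polynomial" "HOL-Computational_Algebra.Primes"
begin

definition seq_poly :: "'a::field list \<Rightarrow> nat \<Rightarrow> 'a poly" where
  "seq_poly us n = (\<Sum>i\<le>n. monom (us ! i) i)"

text \<open>
  The list \<open>us = [u\<^sub>0, \<dots>, u\<^sub>N]\<close> encodes the sequence \<open>f\<^sub>1, \<dots>, f\<^sub>N\<close> with \<open>f\<^sub>n = seq_poly us n\<close>.
  For \<open>N \<ge> 1\<close> the encoding is injective, so counting lists counts sequences.
\<close>
definition consecutive_irreducible :: "nat \<Rightarrow> 'a::field list \<Rightarrow> bool" where
  "consecutive_irreducible N us \<longleftrightarrow>
     length us = N + 1 \<and> 0 \<notin> set us \<and> (\<forall>n\<in>{1..N}. irreducible (seq_poly us n))"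

definition num_consecutive_irreducible :: "'a::{field,finite} itself \<Rightarrow> nat \<Rightarrow> nat" where
  "num_consecutive_irreducible _ N = card {us :: 'a list. consecutive_irreducible N us}"

end

theory Submission imports Defs "HOL-Number_Theory.Residues" begin

text \<open>
  Fix \<open>u\<^sub>0 = b\<close> and \<open>u\<^sub>1 = c\<close>. A quadratic is irreducible iff its discriminant is a non-square, and
  the discriminant \<open>c\<^sup>2 - 4 b d\<close> is a bijective function of \<open>u\<^sub>2 = d\<close>; this gives \<open>I\<^sub>2\<close>.

  For \<open>I\<^sub>3\<close>, pass to reciprocal polynomials: \<open>u\<^sub>3\<close> is admissible if \<open>- u\<^sub>3\<close> is not a value of
  \<open>h\<^sub>d(y) = b y\<^sup>3 + c y\<^sup>2 + d y\<close>. The fibres of \<open>h\<^sub>d\<close> have at most three points, so the number of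
  missed values is at least a third of the number of collisions \<open>h\<^sub>d(x) = h\<^sub>d(y)\<close>, \<open>x \<noteq> y\<close>.
  A pair \<open>x \<noteq> y\<close> collides for exactly one \<open>d\<close>, whose discriminant is
  \<open>(2 b x + b y + c)\<^sup>2 + b y (3 b y + 2 c)\<close>. Summing over all \<open>d\<close> with a non-square discriminant, it
  remains to count the non-squares of the form \<open>u\<^sup>2 + k\<close> with \<open>k \<noteq> 0\<close>, which the factorization
  \<open>v\<^sup>2 - u\<^sup>2 = (v - u) (v + u)\<close> does. The result, \<open>6 I\<^sub>3 \<ge> (q - 1)\<^sup>2 (q - 2) (q - 3)\<close>, is stronger
  than the claim and needs no Weil-type estimate.
\<close>

section \<open>Non-squares and irreducibility in degree at most three\<close>

definition nonsq :: "'a::field \<Rightarrow> bool" where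
  "nonsq t \<longleftrightarrow> (\<forall>v. v\<^sup>2 \<noteq> t)"

lemma two_neq_zero_if_odd_card:
  assumes "odd CARD('a::{field,finite})"
  shows "(2::'a) \<noteq> 0"
proof
  assume z: "(2::'a) = 0"
  then have "of_nat 2 = (0::'a)" by simp
  then have "CHAR('a) dvd 2" by (simp only: of_nat_eq_0_iff_char_dvd)
  moreover have "CHAR('a) \<noteq> 1" by simp
  ultimately have "CHAR('a) = 2"
    using two_is_prime_nat prime_nat_iff by blast
  with CHAR_dvd_CARD[where 'a='a] assms show False by simp
qed

text \<open>A proper factorization in degree two or three has a linear factor, hence a root. The
  guard \<open>degree p > 1\<close> lets the same criterion cover linear polynomials, which do have
  roots.\<close>

lemma no_root_imp_irreducible:
  fixes p :: "'a::field poly"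
  assumes "degree p \<in> {1..3}" and no_root: "\<And>x. degree p > 1 \<Longrightarrow> poly p x \<noteq> 0"
  shows "irreducible p"
proof (rule irreducibleI)
  show "p \<noteq> 0" using assms(1) by auto
  then show "\<not> p dvd 1" using assms(1) by (simp add: is_unit_iff_degree)
  have root: "\<exists>x. poly r x = 0" if "degree r = 1" for r :: "'a poly"
  proof -
    obtain a b where "r = [:a, b:]" "b \<noteq> 0"
      using \<open>degree r = 1\<close> degree1_coeffs by blast
    then have "poly r (- a / b) = 0" by simp
    then show ?thesis ..
  qed
  fix a b assume p: "p = a * b"
  then have nz: "a \<noteq> 0" "b \<noteq> 0" using assms(1) by auto
  then have deg: "degree p = degree a + degree b" using p by (simp add: degree_mult_eq)
  have "degree a = 0 \<or> degree b = 0"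
  proof (rule ccontr)
    assume neg: "\<not> ?thesis"
    then have "degree a = 1 \<or> degree b = 1" "degree p > 1" using deg assms(1) by auto
    then show False using root no_root p by (metis mult_eq_0_iff poly_mult)
  qed
  then show "a dvd 1 \<or> b dvd 1" using nz by (simp add: is_unit_iff_degree)
qed

lemma irreducible_imp_no_root:
  fixes p :: "'a::field poly"
  assumes "irreducible p" and "degree p > 1"
  shows "poly p x \<noteq> 0"
proof
  assume "poly p x = 0"
  then obtain r where r: "p = [:- x, 1:] * r" by (auto simp: poly_eq_0_iff_dvd)
  have "p \<noteq> 0" using assms(2) by auto
  then have "r \<noteq> 0" using r by auto
  then have "degree p = 1 + degree r" unfolding r by (subst degree_mult_eq) auto
  moreover from irreducibleD[OF assms(1) r] have "r dvd 1" by (auto simp: is_unit_iff_degree)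
  then have "degree r = 0" by (simp add: is_unit_iff_degree[OF \<open>r \<noteq> 0\<close>])
  ultimately show False using assms(2) by simp
qed

text \<open>Completing the square turns a root into a square root of the discriminant; since
  \<open>2 * d\<close> is invertible, \<open>2 * d * x + c\<close> runs through the whole
  field.\<close>

lemma irreducible_quadratic_iff:
  fixes b c d :: "'a::field"
  assumes "(2::'a) \<noteq> 0" and "d \<noteq> 0"
  shows "irreducible [:b, c, d:] \<longleftrightarrow> nonsq (c\<^sup>2 - 4 * b * d)"
proof -
  have eq: "4 * d * poly [:b, c, d:] x = (2 * d * x + c)\<^sup>2 - (c\<^sup>2 - 4 * b * d)" for x
    by (simp add: algebra_simps power2_eq_square)
  have "(4::'a) = 2 * 2" by simp
  then have "(4::'a) \<noteq> 0" using assms(1) by (metis mult_eq_0_iff)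
  have "irreducible [:b, c, d:] \<longleftrightarrow> (\<forall>x. poly [:b, c, d:] x \<noteq> 0)"
    using assms(2) no_root_imp_irreducible[of "[:b, c, d:]"]
      irreducible_imp_no_root[of "[:b, c, d:]"] by force
  also have "\<dots> \<longleftrightarrow> (\<forall>x. (2 * d * x + c)\<^sup>2 \<noteq> c\<^sup>2 - 4 * b * d)"
    using eq \<open>4 \<noteq> 0\<close> assms(2) by (metis eq_iff_diff_eq_0 mult_eq_0_iff)
  also have "\<dots> \<longleftrightarrow> nonsq (c\<^sup>2 - 4 * b * d)"
  proof -
    have "\<exists>x. 2 * d * x + c = v" for v
      using assms by (intro exI[of _ "(v - c) / (2 * d)"]) simp
    then show ?thesis unfolding nonsq_def by metis
  qed
  finally show ?thesis .
qed

section \<open>Counting square roots and non-squares\<close>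

lemma card_square_roots:
  fixes t :: "'a::{field,finite}"
  assumes "(2::'a) \<noteq> 0"
  shows "2 * of_bool (nonsq t) + card {v. v\<^sup>2 = t} + of_bool (t = 0) = (2::nat)"
\<comment> \<open>Non-squares have no root, zero has one and every other square has two. Packing
  these cases into one equation lets it be summed over any family of values
  \<open>t\<close>.\<close>
proof (cases "nonsq t")
  case True
  then have "t \<noteq> 0" "{v. v\<^sup>2 = t} = {}" unfolding nonsq_def by (auto intro: power_zero_numeral)
  then show ?thesis using True by simp
next
  case False
  then obtain v where v: "v\<^sup>2 = t" unfolding nonsq_def by auto
  then have roots: "{w. w\<^sup>2 = t} = {v, - v}" by (auto simp: power2_eq_iff)
  have "v = - v \<longleftrightarrow> 2 * v = 0" by (metis eq_neg_iff_add_eq_0 mult_2)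
  then have "card {v, - v} + of_bool (t = 0) = 2"
    using assms v by (auto simp: card_insert_if)
  then show ?thesis using False roots by simp
qed

lemma card_nonsq:
  assumes "(2::'a::{field,finite}) \<noteq> 0"
  shows "2 * card {t::'a. nonsq t} + 1 = CARD('a)"
proof -
  have "2 * CARD('a) = (\<Sum>t\<in>(UNIV::'a set). 2)" by simp
  also have "\<dots> = (\<Sum>t\<in>(UNIV::'a set). 2 * of_bool (nonsq t) + card {v. v\<^sup>2 = t} + of_bool (t = 0))"
    by (simp only: card_square_roots[OF assms])
  also have "\<dots> = 2 * card {t::'a. nonsq t} + (\<Sum>t\<in>(UNIV::'a set). card {v. v\<^sup>2 = t}) + 1"
    by (simp add: sum.distrib flip: sum_distrib_left)
  \<comment> \<open>Each \<open>v\<close> is a square root of exactly one \<open>t\<close>.\<close>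
  also have "(\<Sum>t\<in>(UNIV::'a set). card {v. v\<^sup>2 = t}) = CARD('a)"
    using sum.group[of UNIV UNIV "\<lambda>v::'a. v\<^sup>2" "\<lambda>_. 1::nat"] by simp
  finally show ?thesis by simp
qed

text \<open>The curve reads \<open>(v - u) * (v + u) = k\<close>, so a point is determined by the
  nonzero parameter \<open>m = v + u\<close>, with \<open>v - u = k / m\<close>.\<close>

lemma card_hyperbola:
  fixes k :: "'a::{field,finite}"
  assumes "(2::'a) \<noteq> 0" and "k \<noteq> 0"
  shows "card {(u, v). v\<^sup>2 = u\<^sup>2 + k} = CARD('a) - 1"
proof -
  have "bij_betw (\<lambda>(u, v). v + u) {(u, v). v\<^sup>2 = u\<^sup>2 + k} (UNIV - {0})"
  proof (rule bij_betw_byWitness[where f' = "\<lambda>m. ((m - k / m) / 2, (m + k / m) / 2)"])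
    show "\<forall>p\<in>{(u, v). v\<^sup>2 = u\<^sup>2 + k}.
        (\<lambda>m. ((m - k / m) / 2, (m + k / m) / 2)) ((\<lambda>(u, v). v + u) p) = p"
    proof clarify
      fix u v :: 'a assume "v\<^sup>2 = u\<^sup>2 + k"
      then have k: "k = (v - u) * (v + u)" by (simp add: algebra_simps power2_eq_square)
      then have "v + u \<noteq> 0" using assms(2) by auto
      then have "k / (v + u) = v - u" using k by simp
      moreover have "v + u - (v - u) = 2 * u" "v + u + (v - u) = 2 * v" by simp_all
      ultimately show "(v + u - k / (v + u)) / 2 = u \<and> (v + u + k / (v + u)) / 2 = v"
        using assms(1) by (simp only:) simp
    qed
    show "\<forall>m\<in>UNIV - {0}. (\<lambda>(u, v). v + u) ((m - k / m) / 2, (m + k / m) / 2) = m"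
      using assms(1) by (simp flip: add_divide_distrib mult_2)
    show "(\<lambda>(u, v). v + u) ` {(u, v). v\<^sup>2 = u\<^sup>2 + k} \<subseteq> UNIV - {0}"
    proof clarsimp
      fix u v :: 'a assume *: "v\<^sup>2 = u\<^sup>2 + k" "v + u = 0"
      then have "v = - u" by (simp add: eq_neg_iff_add_eq_0)
      then show False using * assms(2) by simp
    qed
    show "(\<lambda>m. ((m - k / m) / 2, (m + k / m) / 2)) ` (UNIV - {0}) \<subseteq> {(u, v). v\<^sup>2 = u\<^sup>2 + k}"
    proof clarsimp
      fix m :: 'a assume m: "m \<noteq> 0"
      have "((m + k / m) / 2)\<^sup>2 - ((m - k / m) / 2)\<^sup>2
          = ((m + k / m) / 2 + (m - k / m) / 2) * ((m + k / m) / 2 - (m - k / m) / 2)"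
        by (simp add: algebra_simps power2_eq_square)
      also have "(m + k / m) / 2 + (m - k / m) / 2 = m"
        using assms(1) by (simp flip: add_divide_distrib mult_2)
      also have "(m + k / m) / 2 - (m - k / m) / 2 = k / m"
        using assms(1) by (simp flip: diff_divide_distrib mult_2)
      finally show "((m + k / m) / 2)\<^sup>2 = ((m - k / m) / 2)\<^sup>2 + k"
        using m by (simp add: algebra_simps)
    qed
  qed
  then have "card {(u, v). v\<^sup>2 = u\<^sup>2 + k} = card (UNIV - {0::'a})" by (rule bij_betw_same_card)
  then show ?thesis by simp
qed

text \<open>Summing the root count over the values \<open>u^2 + k\<close>, with q the field size,
  gives 2q = 2N + (q - 1) + z, where N counts the non-squares and z \<le> 2 the zeros.\<close>

lemma card_nonsq_shifted_square:
  fixes k :: "'a::{field,finite}"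
  assumes "(2::'a) \<noteq> 0" and "k \<noteq> 0"
  shows "CARD('a) \<le> 2 * card {u::'a. nonsq (u\<^sup>2 + k)} + 1"
proof -
  have "2 * CARD('a) = (\<Sum>u\<in>(UNIV::'a set). 2)" by simp
  also have "\<dots> = (\<Sum>u\<in>UNIV. 2 * of_bool (nonsq (u\<^sup>2 + k)) + card {v. v\<^sup>2 = u\<^sup>2 + k}
      + of_bool (u\<^sup>2 + k = 0))"
    by (simp only: card_square_roots[OF assms(1)])
  also have "\<dots> = 2 * card {u. nonsq (u\<^sup>2 + k)} + (\<Sum>u\<in>UNIV. card {v. v\<^sup>2 = u\<^sup>2 + k})
      + card {u. u\<^sup>2 + k = 0}"
    by (simp add: sum.distrib flip: sum_distrib_left)
  also have "(\<Sum>u\<in>UNIV. card {v. v\<^sup>2 = u\<^sup>2 + k}) = card (SIGMA u:UNIV. {v. v\<^sup>2 = u\<^sup>2 + k})"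
    by simp
  also have "(SIGMA u:UNIV. {v. v\<^sup>2 = u\<^sup>2 + k}) = {(u, v). v\<^sup>2 = u\<^sup>2 + k}" by auto
  also have "card \<dots> = CARD('a) - 1" by (rule card_hyperbola[OF assms])
  also have "card {u. u\<^sup>2 + k = 0} \<le> 2"
    using card_square_roots[OF assms(1), of "- k"] by (simp add: eq_neg_iff_add_eq_0)
  finally show ?thesis by simp
qed

section \<open>Collisions of cubic maps and admissible coefficients\<close>

lemma collisions_le_missed_values:
  fixes h :: "'a::finite \<Rightarrow> 'a"
  assumes "\<And>w. card {x. h x = w} \<le> 3"
  shows "card {(x, y). x \<noteq> y \<and> h x = h y} \<le> 3 * card (- range h)"
proof -
  let ?r = "\<lambda>w. card {x. h x = w}"
  have total: "(\<Sum>w\<in>UNIV. ?r w) = CARD('a)"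
    using sum.group[of UNIV UNIV h "\<lambda>_. 1::nat"] by simp
  have pairs: "card {(x, y). x \<noteq> y \<and> h x = h y} = (\<Sum>w\<in>UNIV. ?r w * (?r w - 1))"
  proof -
    have "{(x, y). x \<noteq> y \<and> h x = h y} = (SIGMA x:UNIV. {y. h y = h x} - {x})" by auto
    also have "card \<dots> = (\<Sum>x\<in>UNIV. ?r (h x) - 1)" by simp
    also have "\<dots> = (\<Sum>w\<in>UNIV. \<Sum>x\<in>{x. h x = w}. ?r (h x) - 1)"
      using sum.group[of UNIV UNIV h "\<lambda>x. ?r (h x) - 1"] by simp
    also have "\<dots> = (\<Sum>w\<in>UNIV. ?r w * (?r w - 1))" by simp
    finally show ?thesis .
  qed
  \<comment> \<open>For a fibre of size r this is r(r - 1) + 3 \<le> 3[r = 0] + 3r, with equality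
    for r = 0, 1, 3. After summation the terms 3q on both sides cancel.\<close>
  have "?r w * (?r w - 1) + 3 \<le> 3 * of_bool (w \<notin> range h) + 3 * ?r w" for w
  proof -
    have "?r w = 0 \<longleftrightarrow> w \<notin> range h" by auto
    moreover have "?r w = 0 \<or> ?r w = 1 \<or> ?r w = 2 \<or> ?r w = 3" using assms[of w] by linarith
    ultimately show ?thesis by auto
  qed
  then have "(\<Sum>w\<in>UNIV. ?r w * (?r w - 1) + 3)
      \<le> (\<Sum>w\<in>UNIV. 3 * of_bool (w \<notin> range h) + 3 * ?r w)"
    by (intro sum_mono)
  also have "\<dots> = 3 * card (- range h) + 3 * CARD('a)"
    by (simp add: sum.distrib total Compl_eq flip: sum_distrib_left)
  finally show ?thesis by (simp add: sum.distrib pairs)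
qed

lemma card_cubic_fibre:
  fixes b c d :: "'a::field"
  assumes "b \<noteq> 0"
  shows "card {x. b * x ^ 3 + c * x\<^sup>2 + d * x = w} \<le> 3"
proof -
  let ?p = "[:- w, d, c, b:]"
  have "{x. b * x ^ 3 + c * x\<^sup>2 + d * x = w} = {x. poly ?p x = 0}"
    by (auto simp: algebra_simps power2_eq_square power3_eq_cube)
  also have "card \<dots> \<le> degree ?p" using assms by (intro card_poly_roots_bound) auto
  also have "\<dots> = 3" using assms by simp
  finally show ?thesis .
qed

text \<open>These are the pairs \<open>(u_2, u_3)\<close> for \<open>u_0 = b\<close>,
  \<open>u_1 = c\<close>. The cubic is the reversal of \<open>f_3\<close>, which makes
  \<open>e\<close> its constant term; \<open>y = 0\<close> forces \<open>e \<noteq> 0\<close>, and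
  \<open>d = 0\<close> is excluded because \<open>c^2\<close> is a square.\<close>

definition admissible :: "'a::field \<Rightarrow> 'a \<Rightarrow> ('a \<times> 'a) set" where
  "admissible b c = {(d, e). nonsq (c\<^sup>2 - 4 * b * d) \<and>
     (\<forall>y. b * y ^ 3 + c * y\<^sup>2 + d * y + e \<noteq> 0)}"

text \<open>For fixed \<open>y\<close> the expression is \<open>u^2 + k\<close> with
  \<open>u\<close> affine in \<open>x\<close> and \<open>k\<close> depending on \<open>y\<close>
  alone. At most two \<open>y\<close> give \<open>k = 0\<close>, and the condition
  \<open>x \<noteq> y\<close> costs at most one \<open>x\<close> for each remaining
  \<open>y\<close>.\<close>

lemma card_nonsq_pairs:
  fixes b c :: "'a::{field,finite}"
  assumes two: "(2::'a) \<noteq> 0" and "b \<noteq> 0" and "c \<noteq> 0"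
  shows "(CARD('a) - 2) * (CARD('a) - 3) \<le> 2 * card {(x, y). x \<noteq> y \<and>
    nonsq ((2 * b * x + b * y + c)\<^sup>2 + b * y * (3 * b * y + 2 * c))}"
proof -
  let ?A = "\<lambda>y. {x. x \<noteq> y \<and> nonsq ((2 * b * x + b * y + c)\<^sup>2 + b * y * (3 * b * y + 2 * c))}"
  let ?Y = "{y. b * y * (3 * b * y + 2 * c) \<noteq> 0}"
  have A: "CARD('a) - 3 \<le> 2 * card (?A y)" if "y \<in> ?Y" for y
  proof -
    let ?k = "b * y * (3 * b * y + 2 * c)"
    have "bij_betw (\<lambda>x. 2 * b * x + b * y + c)
        {x. nonsq ((2 * b * x + b * y + c)\<^sup>2 + ?k)} {u. nonsq (u\<^sup>2 + ?k)}"
      using assms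
      by (intro bij_betw_byWitness[where f' = "\<lambda>u. (u - b * y - c) / (2 * b)"]) auto
    then have "card {x. nonsq ((2 * b * x + b * y + c)\<^sup>2 + ?k)} = card {u. nonsq (u\<^sup>2 + ?k)}"
      by (rule bij_betw_same_card)
    moreover have "card {x. nonsq ((2 * b * x + b * y + c)\<^sup>2 + ?k)} \<le> card (insert y (?A y))"
      by (intro card_mono) auto
    moreover have "card (insert y (?A y)) = card (?A y) + 1" by simp
    ultimately have "card {u. nonsq (u\<^sup>2 + ?k)} \<le> card (?A y) + 1" by linarith
    with card_nonsq_shifted_square[OF two, of ?k] that show ?thesis by simp
  qed
  have "CARD('a) - 2 \<le> card ?Y"
  proof -
    let ?p = "[:0, 2 * b * c, 3 * b * b:]"
    \<comment> \<open>The linear coefficient \<open>2 * b * c\<close> is nonzero even in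
      characteristic three, where the quadratic one vanishes.\<close>
    have "?p \<noteq> 0" using assms by simp
    then have "card {y. poly ?p y = 0} \<le> degree ?p" by (rule card_poly_roots_bound)
    moreover have "degree ?p \<le> 2" by simp
    moreover have "?Y = - {y. poly ?p y = 0}" by (auto simp: algebra_simps)
    ultimately show ?thesis by (simp add: card_Diff_subset Compl_eq_Diff_UNIV)
  qed
  then have "(CARD('a) - 2) * (CARD('a) - 3) \<le> (\<Sum>y\<in>?Y. CARD('a) - 3)" by simp
  also have "\<dots> \<le> (\<Sum>y\<in>?Y. 2 * card (?A y))" using A by (intro sum_mono)
  also have "\<dots> \<le> (\<Sum>y\<in>UNIV. 2 * card (?A y))" by (intro sum_mono2) auto
  also have "\<dots> = 2 * card (SIGMA y:UNIV. ?A y)" by (simp flip: sum_distrib_left)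
  also have "card (SIGMA y:UNIV. ?A y) = card {(x, y). x \<noteq> y \<and>
    nonsq ((2 * b * x + b * y + c)\<^sup>2 + b * y * (3 * b * y + 2 * c))}"
    by (intro bij_betw_same_card[of prod.swap] bij_betwI[where g = prod.swap]) auto
  finally show ?thesis .
qed

lemma card_admissible:
  fixes b c :: "'a::{field,finite}"
  assumes "(2::'a) \<noteq> 0" and "b \<noteq> 0" and "c \<noteq> 0"
  shows "(CARD('a) - 2) * (CARD('a) - 3) \<le> 6 * card (admissible b c)"
proof -
  define h where "h = (\<lambda>d y. b * y ^ 3 + c * y\<^sup>2 + d * y)"
  define D where "D = {d. nonsq (c\<^sup>2 - 4 * b * d)}"
  let ?P = "{(x, y). x \<noteq> y \<and> nonsq ((2 * b * x + b * y + c)\<^sup>2 + b * y * (3 * b * y + 2 * c))}"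
  let ?C = "SIGMA d:D. {(x, y). x \<noteq> y \<and> h d x = h d y}"
  \<comment> \<open>The first component is the \<open>d\<close> obtained by dividing
    \<open>h d x - h d y = 0\<close> by \<open>x - y\<close>.\<close>
  let ?f = "\<lambda>(x, y). (- (b * (x\<^sup>2 + x * y + y\<^sup>2) + c * (x + y)), (x, y))"
  have "?f ` ?P \<subseteq> ?C"
  proof (rule image_subsetI)
    fix z assume "z \<in> ?P"
    then obtain x y where z: "z = (x, y)" "x \<noteq> y"
      and nonsq: "nonsq ((2 * b * x + b * y + c)\<^sup>2 + b * y * (3 * b * y + 2 * c))"
      by auto
    let ?d = "- (b * (x\<^sup>2 + x * y + y\<^sup>2) + c * (x + y))"
    \<comment> \<open>The discriminant is a quadratic in \<open>x\<close>; this completes its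
      square.\<close>
    have "c\<^sup>2 - 4 * b * ?d = (2 * b * x + b * y + c)\<^sup>2 + b * y * (3 * b * y + 2 * c)"
      by (simp add: algebra_simps power2_eq_square)
    moreover have "h ?d x = h ?d y"
      by (simp add: h_def algebra_simps power2_eq_square power3_eq_cube)
    ultimately show "?f z \<in> ?C" using nonsq z unfolding D_def by simp
  qed
  moreover have "inj_on ?f ?P" by (auto intro: inj_onI)
  ultimately have "card ?P \<le> card ?C" by (intro card_inj_on_le[of ?f]) auto
  also have "\<dots> = (\<Sum>d\<in>D. card {(x, y). x \<noteq> y \<and> h d x = h d y})" by simp
  also have "\<dots> \<le> (\<Sum>d\<in>D. 3 * card (- range (h d)))"
    using card_cubic_fibre[OF assms(2)]
    by (intro sum_mono collisions_le_missed_values) (simp add: h_def)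
  \<comment> \<open>Negation turns a missed value into a coefficient \<open>e\<close> for which
    \<open>h d y + e\<close> never vanishes.\<close>
  also have "\<dots> = 3 * (\<Sum>d\<in>D. card (uminus ` (- range (h d))))"
    by (simp add: card_image sum_distrib_left)
  also have "\<dots> = 3 * card (SIGMA d:D. uminus ` (- range (h d)))" by simp
  also have "(SIGMA d:D. uminus ` (- range (h d))) = admissible b c"
  proof -
    have "e \<in> uminus ` (- range (h d)) \<longleftrightarrow> (\<forall>y. h d y + e \<noteq> 0)" for d e
    proof -
      have "e \<in> uminus ` (- range (h d)) \<longleftrightarrow> - e \<notin> range (h d)"
        by (metis ComplD ComplI imageE image_eqI minus_minus)
      then show ?thesis by (auto simp: eq_neg_iff_add_eq_0 image_iff eq_commute[of "- e"])
    qed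
    then show ?thesis by (auto simp: admissible_def D_def h_def)
  qed
  finally show ?thesis using card_nonsq_pairs[OF assms] by linarith
qed

section \<open>Coefficient lists of irreducible sequences\<close>

lemma consecutive_irreducible_2_iff:
  fixes us :: "'a::field list"
  assumes "(2::'a) \<noteq> 0"
  shows "consecutive_irreducible 2 us \<longleftrightarrow>
    (\<exists>b c d. us = [b, c, d] \<and> b \<noteq> 0 \<and> c \<noteq> 0 \<and> nonsq (c\<^sup>2 - 4 * b * d))"
proof -
  have "d \<noteq> 0" if "nonsq (c\<^sup>2 - 4 * b * d)" for b c d :: 'a
    using that by (auto simp: nonsq_def)
  moreover have "irreducible [:b, c:]" if "c \<noteq> 0" for b c :: 'a
    using that by (intro no_root_imp_irreducible) auto
  moreover have "seq_poly [b, c, d] 1 = [:b, c:]" "seq_poly [b, c, d] 2 = [:b, c, d:]" for b c d :: 'a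
    by (simp_all add: seq_poly_def numeral_2_eq_2 monom_Suc monom_0)
  moreover have "{1..2} = {1, 2::nat}" by auto
  moreover have "length us = 2 + 1 \<longleftrightarrow> (\<exists>b c d. us = [b, c, d])"
    by (auto simp: numeral_2_eq_2 length_Suc_conv)
  ultimately show ?thesis
    using irreducible_quadratic_iff[OF assms] unfolding consecutive_irreducible_def by force
qed

lemma consecutive_irreducible_3I:
  fixes b c d e :: "'a::field"
  assumes "(2::'a) \<noteq> 0" and "b \<noteq> 0" and "c \<noteq> 0" and "(d, e) \<in> admissible b c"
  shows "consecutive_irreducible 3 [b, c, d, e]"
proof -
  have nonsq: "nonsq (c\<^sup>2 - 4 * b * d)" and no_root: "b * y ^ 3 + c * y\<^sup>2 + d * y + e \<noteq> 0" for y
    using assms(4) by (auto simp: admissible_def)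
  have "d \<noteq> 0" using nonsq by (auto simp: nonsq_def)
  have "e \<noteq> 0" using no_root[of 0] by simp
  \<comment> \<open>Nonzero roots of the cubic are reciprocals of roots of its reversal; at zero its
    value is \<open>b\<close>.\<close>
  have "poly [:b, c, d, e:] x \<noteq> 0" for x
  proof (cases "x = 0")
    case False
    then have "poly [:b, c, d, e:] x
        = x ^ 3 * (b * inverse x ^ 3 + c * (inverse x)\<^sup>2 + d * inverse x + e)"
      by (simp add: field_simps power2_eq_square power3_eq_cube)
    then show ?thesis using no_root False by simp
  qed (use assms in simp)
  then have "irreducible [:b, c, d, e:]"
    using \<open>e \<noteq> 0\<close> by (intro no_root_imp_irreducible) auto
  moreover have "irreducible [:b, c, d:]"
    using irreducible_quadratic_iff assms(1) \<open>d \<noteq> 0\<close> nonsq by blast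
  moreover have "irreducible [:b, c:]"
    using assms(3) by (intro no_root_imp_irreducible) auto
  moreover have "seq_poly [b, c, d, e] 1 = [:b, c:]" "seq_poly [b, c, d, e] 2 = [:b, c, d:]"
    "seq_poly [b, c, d, e] 3 = [:b, c, d, e:]"
    by (simp_all add: seq_poly_def numeral_2_eq_2 numeral_3_eq_3 monom_Suc monom_0)
  moreover have "{1..3} = {1, 2, 3::nat}" by auto
  ultimately show ?thesis
    using assms \<open>d \<noteq> 0\<close> \<open>e \<noteq> 0\<close> by (simp add: consecutive_irreducible_def)
qed

section \<open>Counting sequences of length two and three\<close>

lemma num_consecutive_irreducible_2:
  assumes "(2::'a::{field,finite}) \<noteq> 0"
  shows "2 * num_consecutive_irreducible TYPE('a) 2 = (CARD('a) - 1) ^ 3"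
proof -
  let ?U = "UNIV - {0::'a}"
  let ?S = "SIGMA b:?U. SIGMA c:?U. {d. nonsq (c\<^sup>2 - 4 * b * d)}"
  have S: "2 * card {d. nonsq (c\<^sup>2 - 4 * b * d)} = CARD('a) - 1" if "b \<noteq> 0" for b c :: 'a
  proof -
    have "(4::'a) = 2 * 2" by simp
    then have "(4::'a) \<noteq> 0" using assms by (metis mult_eq_0_iff)
    then have "bij_betw (\<lambda>d. c\<^sup>2 - 4 * b * d) {d. nonsq (c\<^sup>2 - 4 * b * d)} {t. nonsq t}"
      using that by (intro bij_betw_byWitness[where f' = "\<lambda>t. (c\<^sup>2 - t) / (4 * b)"]) auto
    then show ?thesis using bij_betw_same_card card_nonsq[OF assms] by fastforce
  qed
  have "{us::'a list. consecutive_irreducible 2 us} = (\<lambda>(b, c, d). [b, c, d]) ` ?S"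
    unfolding consecutive_irreducible_2_iff[OF assms] by force
  moreover have "inj_on (\<lambda>(b, c, d). [b, c, d]) ?S" by (auto intro: inj_onI)
  ultimately have "num_consecutive_irreducible TYPE('a) 2 = card ?S"
    by (simp only: num_consecutive_irreducible_def card_image)
  also have "\<dots> = (\<Sum>b\<in>?U. \<Sum>c\<in>?U. card {d. nonsq (c\<^sup>2 - 4 * b * d)})" by simp
  finally have "2 * num_consecutive_irreducible TYPE('a) 2 = (\<Sum>b\<in>?U. \<Sum>c\<in>?U. CARD('a) - 1)"
    using S by (simp add: sum_distrib_left)
  then show ?thesis by (simp add: power3_eq_cube)
qed

lemma num_consecutive_irreducible_3:
  assumes "(2::'a::{field,finite}) \<noteq> 0"
  shows "(CARD('a) - 1)\<^sup>2 * ((CARD('a) - 2) * (CARD('a) - 3))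
    \<le> 6 * num_consecutive_irreducible TYPE('a) 3"
proof -
  let ?U = "UNIV - {0::'a}"
  let ?S = "SIGMA b:?U. SIGMA c:?U. admissible b c"
  have "(CARD('a) - 1)\<^sup>2 * ((CARD('a) - 2) * (CARD('a) - 3))
      = (\<Sum>b\<in>?U. \<Sum>c\<in>?U. (CARD('a) - 2) * (CARD('a) - 3))"
    by (simp add: power2_eq_square)
  also have "\<dots> \<le> (\<Sum>b\<in>?U. \<Sum>c\<in>?U. 6 * card (admissible b c))"
    by (intro sum_mono card_admissible assms) auto
  also have "\<dots> = 6 * card ?S" by (simp add: sum_distrib_left)
  also have "card ?S \<le> card {us::'a list. consecutive_irreducible 3 us}"
  proof (rule card_inj_on_le[where f = "\<lambda>(b, c, d, e). [b, c, d, e]"])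
    show "inj_on (\<lambda>(b, c, d, e). [b, c, d, e]) ?S" by (auto intro: inj_onI)
    show "(\<lambda>(b, c, d, e). [b, c, d, e]) ` ?S \<subseteq> {us. consecutive_irreducible 3 us}"
      using consecutive_irreducible_3I[OF assms] by auto
    have "{us::'a list. consecutive_irreducible 3 us} \<subseteq> {us. set us \<subseteq> UNIV \<and> length us = 4}"
      by (auto simp: consecutive_irreducible_def)
    then show "finite {us::'a list. consecutive_irreducible 3 us}"
      by (rule finite_subset) (intro finite_lists_length_eq finite)
  qed
  finally show ?thesis by (simp add: num_consecutive_irreducible_def)
qed

theorem theorem5p5:
  fixes p s q :: nat
  assumes "prime p" and "odd p" and "s \<ge> 1" and "q = p ^ s"
    and "CARD('a::{field,finite}) = q"
  shows "real (num_consecutive_irreducible TYPE('a) 2) = 1 / 2 * (real q - 1) ^ 3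
    \<and> (q > 13 \<longrightarrow>
         real (num_consecutive_irreducible TYPE('a) 3) \<ge>
           1 / 6 * (real q - 1) ^ 2 * (real q - 9) * (real q - 2 * sqrt (real q) - 6))"
proof (intro conjI impI)
  have "odd CARD('a)" using assms by simp
  then have two: "(2::'a) \<noteq> 0" by (rule two_neq_zero_if_odd_card)
  have "q \<ge> 1" using \<open>odd CARD('a)\<close> assms(5) by (cases q) auto
  \<comment> \<open>With \<open>q \<ge> 1\<close> the truncated subtraction on naturals agrees with
    the real one.\<close>
  then have q1: "real (q - 1) = real q - 1" by simp
  have "2 * num_consecutive_irreducible TYPE('a) 2 = (q - 1) ^ 3"
    using num_consecutive_irreducible_2[OF two] assms(5) by simp
  then have "2 * real (num_consecutive_irreducible TYPE('a) 2) = (real q - 1) ^ 3"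
    by (metis of_nat_mult of_nat_numeral of_nat_power q1)
  then show "real (num_consecutive_irreducible TYPE('a) 2) = 1 / 2 * (real q - 1) ^ 3" by simp
  assume "q > 13"
  then have q: "real q > 13" "real (q - 2) = real q - 2" "real (q - 3) = real q - 3" by auto
  have "(q - 1)\<^sup>2 * ((q - 2) * (q - 3)) \<le> 6 * num_consecutive_irreducible TYPE('a) 3"
    using num_consecutive_irreducible_3[OF two] assms(5) by simp
  then have "real ((q - 1)\<^sup>2 * ((q - 2) * (q - 3)))
      \<le> real (6 * num_consecutive_irreducible TYPE('a) 3)"
    by (simp only: of_nat_le_iff)
  then have I3: "(real q - 1)\<^sup>2 * ((real q - 2) * (real q - 3))
      \<le> 6 * real (num_consecutive_irreducible TYPE('a) 3)"
    by (simp only: of_nat_mult of_nat_power of_nat_numeral q1 q)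
  \<comment> \<open>As \<open>q > 13\<close>, the factor \<open>q - 9\<close> is positive, so
    \<open>q - 2 * sqrt q - 6\<close> may be raised to \<open>q - 3\<close>, and then
    \<open>q - 9\<close> to \<open>q - 2\<close>.\<close>
  have "(real q - 9) * (real q - 2 * sqrt (real q) - 6) \<le> (real q - 9) * (real q - 3)"
    using q real_sqrt_ge_zero[of "real q"] by (intro mult_left_mono) linarith+
  also have "\<dots> \<le> (real q - 2) * (real q - 3)"
    using q by (intro mult_right_mono) auto
  finally have "(real q - 1)\<^sup>2 * ((real q - 9) * (real q - 2 * sqrt (real q) - 6))
      \<le> (real q - 1)\<^sup>2 * ((real q - 2) * (real q - 3))"
    by (intro mult_left_mono) auto
  then show "real (num_consecutive_irreducible TYPE('a) 3) \<ge>
      1 / 6 * (real q - 1) ^ 2 * (real q - 9) * (real q - 2 * sqrt (real q) - 6)"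
    using I3 by (simp add: mult.assoc)
qed

end
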